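(* For every integer $n\ge 2$ let $(G^5_n,\boldsymbol c^5_n)$ be the EWMCP instance and $\mathscr C^5_n$ the coloring of $G^5_n$, of cardinality $n+1$, defined in the context, and let $\prec^5_n$ be any total order of the independent sets in $\mathscr C^5_n$. Then $$\frac{\mathrm{UB}_3(G^5_n,\boldsymbol c^5_n,n+1)}{\mathrm{UB}_2(G^5_n,\boldsymbol c^5_n,\mathscr C^5_n,\prec^5_n)}\to+\infty\quad\text{as } n\to+\infty .$$
   Context: An instance of the Edge-Weighted Maximum Clique Problem (EWMCP) is a pair $(G,\boldsymbol c)$ where $G=(V,E)$ is a finite simple undirected graph and $\boldsymbol c=(c_e)_{e\in E}$ is a vector of nonnegative integer edge-weights. For $u\in V$, $\delta(u)\subseteq E$ is the set of edges incident to $u$. A coloring $\mathscr C$ of the vertices of $G$ is a partition of $V$ into disjoint non-empty independent sets (sets of pairwise non-adjacent vertices). Second upper bound. Let $\prec$ be a (strict) total order on the coloring $\mathscr C$, and let $I(u)\in\mathscr C$ denote the unique member of $\mathscr C$ containing $u\in V$. For $u\in V$ set $$\sigma_u:=\sum_{I\in\mathscr C:\,I\prec I(u)}\max\{c_e: e=\{u,v\}\in\delta(u),\ v\in I\},$$ where the maximum is $0$ if no such edge exists. Then $$\mathrm{UB}_2(G,\boldsymbol c,\mathscr C,\prec):=\sum_{I\in\mathscr C}\max\{\sigma_u:u\in I\}.$$ Third upper bound. Let $k$ be an integer with $1\le k\le|V|$ that is an upper bound on the cardinality of every clique of $G$. For $u\in V$ and an integer $t\ge0$, $\delta_t(u)\subseteq\delta(u)$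 denotes any set of the $\min\{t,|\delta(u)|\}$ heaviest edges incident to $u$. Set $\eta_u:=\frac12\sum_{e\in\delta_{k-1}(u)}c_e$ for $u\in V$, and order the vertices as $\varphi(1),\dots,\varphi(|V|)$ with $\eta_{\varphi(1)}\ge\eta_{\varphi(2)}\ge\dots\ge\eta_{\varphi(|V|)}$ (ties broken arbitrarily). Then $$\mathrm{UB}_3(G,\boldsymbol c,k):=\sum_{j=1}^{k}\eta_{\varphi(j)}.$$ The instances. For every integer $n\ge2$, $G^5_n$ has vertex set $\{1,\dots,2n\}$, partitioned into an independent set $I=\{1,\dots,n\}$ and a clique $C=\{n+1,\dots,2n\}$. The edges are all edges between distinct vertices of $C$, each of weight $0$, and all edges joining a vertex of $I$ to a vertex of $C$, each of weight $1$. These weights define $\boldsymbol c^5_n$. The coloring is $\mathscr C^5_n=\{I,\{n+1\},\{n+2\},\dots,\{2n\}\}$. *)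

theory Defs
  imports Complex_Main "HOL-Library.Ramsey" "HOL-Library.Disjoint_Sets"
begin

text \<open>
  A graph is given by its vertex set \<open>V\<close> and its edge set \<open>E\<close>, edges being two-element sets
  of vertices. Nonnegative integer weights are natural numbers; a weight function is
  only ever evaluated on edges. Cliques and independent sets are those of HOL-Library.Ramsey.
\<close>

definition simple_graph :: "'a set \<Rightarrow> 'a set set \<Rightarrow> bool" where
  "simple_graph V E \<longleftrightarrow> finite V \<and> E \<subseteq> nsets V 2"

definition incident :: "'a set set \<Rightarrow> 'a \<Rightarrow> 'a set set" where
  "incident E u = {e \<in> E. u \<in> e}"

definition coloring :: "'a set \<Rightarrow> 'a set set \<Rightarrow> 'a set set \<Rightarrow> bool" where
  "coloring V E \<C> \<longleftrightarrow> partition_on V \<C> \<and> (\<forall>I\<in>\<C>. indep I E)"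

definition clique_bound :: "'a set \<Rightarrow> 'a set set \<Rightarrow> nat \<Rightarrow> bool" where
  "clique_bound V E k \<longleftrightarrow> (\<forall>K. K \<subseteq> V \<and> clique K E \<longrightarrow> card K \<le> k)"

definition strict_total_order_on :: "'b set \<Rightarrow> ('b \<Rightarrow> 'b \<Rightarrow> bool) \<Rightarrow> bool" where
  "strict_total_order_on A R \<longleftrightarrow> irreflp_on A R \<and> transp_on A R \<and> totalp_on A R"


section \<open>The second upper bound\<close>

definition class_of :: "'a set set \<Rightarrow> 'a \<Rightarrow> 'a set" where
  "class_of \<C> u = (THE I. I \<in> \<C> \<and> u \<in> I)"

definition max_weight :: "('a set \<Rightarrow> nat) \<Rightarrow> 'a set set \<Rightarrow> nat" where
  "max_weight c F = (if F = {} then 0 else Max (c ` F))"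

definition sigma ::
  "'a set set \<Rightarrow> ('a set \<Rightarrow> nat) \<Rightarrow> 'a set set \<Rightarrow> ('a set \<Rightarrow> 'a set \<Rightarrow> bool) \<Rightarrow> 'a \<Rightarrow> nat" where
  "sigma E c \<C> prec u =
     (\<Sum>I\<in>{I \<in> \<C>. prec I (class_of \<C> u)}. max_weight c {e \<in> incident E u. \<exists>v\<in>I. e = {u, v}})"

definition UB2 ::
  "'a set set \<Rightarrow> ('a set \<Rightarrow> nat) \<Rightarrow> 'a set set \<Rightarrow> ('a set \<Rightarrow> 'a set \<Rightarrow> bool) \<Rightarrow> nat" where
  "UB2 E c \<C> prec = (\<Sum>I\<in>\<C>. Max (sigma E c \<C> prec ` I))"


section \<open>The third upper bound\<close>

definition is_heaviest :: "'a set set \<Rightarrow> ('a set \<Rightarrow> nat) \<Rightarrow> nat \<Rightarrow> 'a \<Rightarrow> 'a set set \<Rightarrow> bool" where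
  "is_heaviest E c t u D \<longleftrightarrow>
     D \<subseteq> incident E u \<and> card D = min t (card (incident E u)) \<and>
     (\<forall>e\<in>D. \<forall>f\<in>incident E u - D. c f \<le> c e)"

definition heaviest :: "'a set set \<Rightarrow> ('a set \<Rightarrow> nat) \<Rightarrow> nat \<Rightarrow> 'a \<Rightarrow> 'a set set" where
  "heaviest E c t u = (SOME D. is_heaviest E c t u D)"

definition eta :: "'a set set \<Rightarrow> ('a set \<Rightarrow> nat) \<Rightarrow> nat \<Rightarrow> 'a \<Rightarrow> real" where
  "eta E c k u = 1/2 * (\<Sum>e\<in>heaviest E c (k - 1) u. real (c e))"

definition is_descending_order :: "'b set \<Rightarrow> ('b \<Rightarrow> real) \<Rightarrow> (nat \<Rightarrow> 'b) \<Rightarrow> bool" where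
  "is_descending_order V h \<phi> \<longleftrightarrow>
     bij_betw \<phi> {1..card V} V \<and>
     (\<forall>i\<in>{1..card V}. \<forall>j\<in>{1..card V}. i \<le> j \<longrightarrow> h (\<phi> j) \<le> h (\<phi> i))"

definition descending_order :: "'b set \<Rightarrow> ('b \<Rightarrow> real) \<Rightarrow> nat \<Rightarrow> 'b" where
  "descending_order V h = (SOME \<phi>. is_descending_order V h \<phi>)"

text \<open>
  The arbitrary choices in \<^const>\<open>heaviest\<close> and \<^const>\<open>descending_order\<close> exist and do not affect
  the value of the bound: see \<open>is_heaviest_heaviest\<close>, \<open>is_descending_order_descending_order\<close>
  and \<open>UB3_choice\<close> below.
\<close>

definition UB3 :: "'a set \<Rightarrow> 'a set set \<Rightarrow> ('a set \<Rightarrow> nat) \<Rightarrow> nat \<Rightarrow> real" where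
  "UB3 V E c k = (\<Sum>j=1..k. eta E c k (descending_order V (eta E c k) j))"

lemma is_descending_order_descending_order:
  assumes "finite V"
  shows "is_descending_order V h (descending_order V h)"
proof -
  obtain ys where ys: "set ys = V" "distinct ys"
    using assms finite_distinct_list by blast
  define xs where "xs = sort_key (\<lambda>x. - h x) ys"
  have xs: "set xs = V" "distinct xs" "sorted (map (\<lambda>x. - h x) xs)"
    using ys by (simp_all add: xs_def)
  have len: "length xs = card V"
    using xs distinct_card by fastforce
  define \<phi> where "\<phi> = (\<lambda>j. xs ! (j - 1))"
  have "bij_betw (\<lambda>j. j - 1) {1..card V} {..<length xs}"
    by (rule bij_betw_byWitness[where f' = Suc]) (auto simp: len)
  moreover have "bij_betw ((!) xs) {..<length xs} V"
    using xs by (intro bij_betw_nth) auto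
  ultimately have "bij_betw \<phi> {1..card V} V"
    using bij_betw_trans[of "\<lambda>j. j - 1" "{1..card V}" "{..<length xs}" "(!) xs" V]
    by (simp add: \<phi>_def comp_def)
  moreover have "h (\<phi> j) \<le> h (\<phi> i)" if "i \<in> {1..card V}" "j \<in> {1..card V}" "i \<le> j" for i j
    using sorted_nth_mono[OF xs(3), of "i - 1" "j - 1"] that len by (auto simp: \<phi>_def)
  ultimately have "is_descending_order V h \<phi>"
    by (auto simp: is_descending_order_def)
  then show ?thesis
    unfolding descending_order_def by (rule someI[where P = "is_descending_order V h"])
qed

lemma incident_finite:
  assumes "simple_graph V E"
  shows "finite (incident E u)"
  using assms finite_subset[OF _ finite_imp_finite_nsets, of E V 2]
  by (auto simp: simple_graph_def incident_def)

lemma descending_order_top: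
  assumes "is_descending_order V h \<phi>" "k \<le> card V"
  shows "\<phi> ` {1..k} \<subseteq> V" "card (\<phi> ` {1..k}) = k" "inj_on \<phi> {1..k}"
    "\<forall>x\<in>\<phi> ` {1..k}. \<forall>y\<in>V - \<phi> ` {1..k}. h y \<le> h x"
proof -
  have bij: "bij_betw \<phi> {1..card V} V"
    and mono: "\<And>i j. \<lbrakk>i \<in> {1..card V}; j \<in> {1..card V}; i \<le> j\<rbrakk> \<Longrightarrow> h (\<phi> j) \<le> h (\<phi> i)"
    using assms(1) by (auto simp: is_descending_order_def)
  have sub: "{1..k} \<subseteq> {1..card V}"
    using assms(2) by auto
  show inj: "inj_on \<phi> {1..k}"
    using bij sub by (meson bij_betw_def inj_on_subset)
  show "\<phi> ` {1..k} \<subseteq> V"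
    using bij sub by (auto simp: bij_betw_def)
  show "card (\<phi> ` {1..k}) = k"
    using inj by (simp add: card_image)
  show "\<forall>x\<in>\<phi> ` {1..k}. \<forall>y\<in>V - \<phi> ` {1..k}. h y \<le> h x"
  proof (intro ballI)
    fix x y assume x: "x \<in> \<phi> ` {1..k}" and y: "y \<in> V - \<phi> ` {1..k}"
    obtain i where i: "i \<in> {1..k}" "x = \<phi> i" using x by auto
    obtain j where j: "j \<in> {1..card V}" "y = \<phi> j"
      using y bij unfolding bij_betw_def by blast
    have "j \<notin> {1..k}" using y j by auto
    then have "i \<le> j" using i j by auto
    then show "h y \<le> h x" using mono[of i j] i j sub by auto
  qed
qed

lemma is_heaviest_heaviest:
  assumes "simple_graph V E"
  shows "is_heaviest E c t u (heaviest E c t u)"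
proof -
  let ?S = "incident E u"
  let ?h = "\<lambda>e. real (c e)"
  let ?t = "min t (card ?S)"
  have "is_descending_order ?S ?h (descending_order ?S ?h)"
    by (rule is_descending_order_descending_order[OF incident_finite[OF assms]])
  from descending_order_top[OF this, of ?t]
  have "is_heaviest E c t u (descending_order ?S ?h ` {1..?t})"
    by (simp add: is_heaviest_def)
  then show ?thesis
    unfolding heaviest_def by (rule someI)
qed

lemma sum_top_unique:
  fixes f :: "'b \<Rightarrow> real"
  assumes "finite S" "A \<subseteq> S" "B \<subseteq> S" "card A = card B"
    and "\<forall>x\<in>A. \<forall>y\<in>S - A. f y \<le> f x" "\<forall>x\<in>B. \<forall>y\<in>S - B. f y \<le> f x"
  shows "sum f A = sum f B"
proof -
  have fin: "finite A" "finite B"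
    using assms(1-3) by (auto intro: finite_subset)
  have card: "card (A - B) = card (B - A)"
    using card_Diff_subset_Int[of A B] card_Diff_subset_Int[of B A] fin assms(4)
    by (simp add: Int_commute)
  have "sum f (A - B) = sum f (B - A)"
  proof (cases "A - B = {}")
    case True
    then have "card (B - A) = 0" using card by (metis card.empty)
    then have "B - A = {}" using fin by simp
    with True show ?thesis by simp
  next
    case False
    then obtain b where b: "b \<in> B - A"
      using card fin by (metis card_0_eq equals0I finite_Diff)
    obtain a where a: "a \<in> A - B" using False by blast
    have eq: "f x = f y" if "x \<in> A - B" "y \<in> B - A" for x y
      using assms that by (intro antisym) auto
    have "sum f (A - B) = (\<Sum>x\<in>A - B. f b)" using eq b by (intro sum.cong) auto
    also have "\<dots> = (\<Sum>x\<in>B - A. f b)" using card by simp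
    also have "\<dots> = sum f (B - A)" using eq a b by (intro sum.cong) metis+
    finally show ?thesis .
  qed
  moreover have "sum f A = sum f (A \<inter> B) + sum f (A - B)"
    using fin by (simp add: sum.Int_Diff)
  moreover have "sum f B = sum f (A \<inter> B) + sum f (B - A)"
    using fin by (metis Int_commute sum.Int_Diff)
  ultimately show ?thesis by simp
qed

lemma UB3_choice:
  assumes G: "simple_graph V E" and k: "k \<le> card V"
    and D: "\<And>u. u \<in> V \<Longrightarrow> is_heaviest E c (k - 1) u (D u)"
    and h: "\<And>u. u \<in> V \<Longrightarrow> h u = 1/2 * (\<Sum>e\<in>D u. real (c e))"
    and \<phi>: "is_descending_order V h \<phi>"
  shows "UB3 V E c k = (\<Sum>j=1..k. h (\<phi> j))"
proof -
  have finV: "finite V" using G by (simp add: simple_graph_def)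
  have eta: "eta E c k u = h u" if "u \<in> V" for u
    unfolding eta_def h[OF that]
    using sum_top_unique[OF incident_finite[OF G], of "heaviest E c (k - 1) u" u "D u" "\<lambda>e. real (c e)"]
      D[OF that] is_heaviest_heaviest[OF G, of c "k - 1" u]
    by (auto simp: is_heaviest_def)
  define \<psi> where "\<psi> = descending_order V (eta E c k)"
  have "is_descending_order V (eta E c k) \<psi>"
    unfolding \<psi>_def by (rule is_descending_order_descending_order[OF finV])
  note \<psi> = descending_order_top[OF this k]
  note \<phi> = descending_order_top[OF \<phi> k]
  have "UB3 V E c k = sum (eta E c k) (\<psi> ` {1..k})"
    using \<psi>(3) by (simp add: UB3_def \<psi>_def sum.reindex)
  also have "\<dots> = sum h (\<psi> ` {1..k})"
    using \<psi>(1) eta by (intro sum.cong) auto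
  also have "\<dots> = sum h (\<phi> ` {1..k})"
  proof (rule sum_top_unique[OF finV \<psi>(1) \<phi>(1)])
    show "\<forall>x\<in>\<psi> ` {1..k}. \<forall>y\<in>V - \<psi> ` {1..k}. h y \<le> h x"
      using \<psi>(1) \<psi>(4) eta by (metis DiffD1 subsetD)
  qed (use \<psi> \<phi> in auto)
  also have "\<dots> = (\<Sum>j=1..k. h (\<phi> j))"
    using \<phi>(3) by (simp add: sum.reindex)
  finally show ?thesis .
qed


section \<open>The instances\<close>

definition indep5 :: "nat \<Rightarrow> nat set" where
  "indep5 n = {1..n}"

definition clique5 :: "nat \<Rightarrow> nat set" where
  "clique5 n = {n + 1..2 * n}"

definition V5 :: "nat \<Rightarrow> nat set" where
  "V5 n = {1..2 * n}"

definition cross5 :: "nat \<Rightarrow> nat set set" where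
  "cross5 n = {{u, v} | u v. u \<in> indep5 n \<and> v \<in> clique5 n}"

definition E5 :: "nat \<Rightarrow> nat set set" where
  "E5 n = nsets (clique5 n) 2 \<union> cross5 n"

definition c5 :: "nat \<Rightarrow> nat set \<Rightarrow> nat" where
  "c5 n e = (if e \<in> cross5 n then 1 else 0)"

definition C5 :: "nat \<Rightarrow> nat set set" where
  "C5 n = insert (indep5 n) ((\<lambda>v. {v}) ` clique5 n)"

lemma simple_graph_5: "simple_graph (V5 n) (E5 n)"
proof -
  have "e \<in> nsets (V5 n) 2" if "e \<in> E5 n" for e
    using that
    by (auto simp: V5_def E5_def nsets_def cross5_def indep5_def clique5_def)
  then show ?thesis by (auto simp: simple_graph_def V5_def)
qed

lemma clique_bound_5: "clique_bound (V5 n) (E5 n) (n + 1)"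
  unfolding clique_bound_def
proof (intro allI impI)
  fix K assume K: "K \<subseteq> V5 n \<and> clique K (E5 n)"
  have fin: "finite K" using K by (auto simp: V5_def intro: finite_subset)
  have "u = v" if "u \<in> K \<inter> indep5 n" "v \<in> K \<inter> indep5 n" for u v
  proof (rule ccontr)
    assume "u \<noteq> v"
    then have "{u, v} \<in> E5 n" using K that by (auto simp: clique_def)
    then show False using that
      by (auto simp: E5_def cross5_def nsets_def indep5_def clique5_def doubleton_eq_iff)
  qed
  then have "card (K \<inter> indep5 n) \<le> 1"
    using fin by (auto simp: card_le_Suc0_iff_eq)
  moreover have "card (K \<inter> clique5 n) \<le> n"
    using card_mono[of "clique5 n" "K \<inter> clique5 n"] by (simp add: clique5_def)
  moreover have "K = (K \<inter> indep5 n) \<union> (K \<inter> clique5 n)"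
    using K by (auto simp: V5_def indep5_def clique5_def)
  then have "card K \<le> card (K \<inter> indep5 n) + card (K \<inter> clique5 n)"
    by (metis card_Un_le)
  ultimately show "card K \<le> n + 1" by linarith
qed

end

theory Submission
  imports Defs
begin

text \<open>
  Both bounds have a closed form on these instances, the second one with the same value for every
  order of the colour classes.

  In the second bound, every pair consisting of the class \<open>I\<close> and a singleton class \<open>{v}\<close> is
  charged exactly once, to whichever of the two comes later, and the charge is the weight \<open>1\<close> of
  an edge between them: if \<open>{v}\<close> precedes \<open>I\<close>, it adds \<open>1\<close> to \<open>\<sigma>\<close> of every vertex of \<open>I\<close>
  simultaneously, hence \<open>1\<close> to their maximum; if \<open>I\<close> precedes \<open>{v}\<close>, it adds only \<open>1\<close> to
  \<open>\<sigma>\<close> of \<open>v\<close>, although \<open>n\<close> edges join \<open>v\<close> to \<open>I\<close>. Pairs of singletons cost nothing. So the second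
  bound is \<open>n\<close> (\<open>UB2_5\<close>).

  The third bound does not see the colouring: every vertex, in \<open>I\<close> or in \<open>C\<close>, is incident to
  exactly \<open>n\<close> edges of weight \<open>1\<close>, and these are its \<open>n\<close> heaviest ones. So \<open>\<eta> = n/2\<close> everywhere,
  and the third bound is \<open>(n + 1) n / 2\<close> (\<open>UB3_5\<close>). The ratio \<open>(n + 1) / 2\<close> tends to infinity.
\<close>

lemma class_of_partition:
  assumes "partition_on V \<C>" "I \<in> \<C>" "u \<in> I"
  shows "class_of \<C> u = I"
  unfolding class_of_def
proof (rule the_equality)
  show "J = I" if "J \<in> \<C> \<and> u \<in> J" for J
    using that assms by (auto simp: partition_on_def disjoint_def)
qed (use assms in simp)

lemma indep5_clique5_disjoint: "indep5 n \<inter> clique5 n = {}"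
  by (auto simp: indep5_def clique5_def)

lemma doubleton_in_cross5_iff:
  "{u, v} \<in> cross5 n \<longleftrightarrow>
     u \<in> indep5 n \<and> v \<in> clique5 n \<or> v \<in> indep5 n \<and> u \<in> clique5 n"
  by (auto simp: cross5_def doubleton_eq_iff)

lemma doubleton_in_E5_iff:
  "{u, v} \<in> E5 n \<longleftrightarrow>
     {u, v} \<in> cross5 n \<or> u \<noteq> v \<and> u \<in> clique5 n \<and> v \<in> clique5 n"
  by (auto simp: E5_def nsets_def card_2_iff doubleton_eq_iff)

lemma indep5_not_singleton_class:
  assumes "n \<ge> 1"
  shows "indep5 n \<notin> (\<lambda>v. {v}) ` clique5 n"
  using indep5_clique5_disjoint[of n] by auto

lemma coloring_5:
  assumes "n \<ge> 1"
  shows "coloring (V5 n) (E5 n) (C5 n)"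
proof -
  have "partition_on (V5 n) (C5 n)"
    using assms
    by (auto simp: partition_on_def disjoint_def C5_def V5_def indep5_def clique5_def)
  moreover have "indep (indep5 n) (E5 n)"
    using indep5_clique5_disjoint[of n]
    by (auto simp: indep_def doubleton_in_E5_iff doubleton_in_cross5_iff)
  moreover have "indep {v} (E5 n)" for v
    by (simp add: indep_def)
  ultimately show ?thesis
    by (auto simp: coloring_def C5_def)
qed

lemma card_C5:
  assumes "n \<ge> 1"
  shows "card (C5 n) = n + 1"
proof -
  have "card ((\<lambda>v. {v}) ` clique5 n) = n"
    by (simp add: card_image clique5_def)
  then show ?thesis
    using indep5_not_singleton_class[OF assms] by (simp add: C5_def clique5_def)
qed

lemma class_of_indep5:
  assumes "u \<in> indep5 n"
  shows "class_of (C5 n) u = indep5 n"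
proof -
  have "n \<ge> 1" using assms by (simp add: indep5_def)
  then show ?thesis
    using class_of_partition[of "V5 n" "C5 n" "indep5 n" u] coloring_5[of n] assms
    by (simp add: coloring_def C5_def)
qed

lemma class_of_clique5:
  assumes "v \<in> clique5 n"
  shows "class_of (C5 n) v = {v}"
proof -
  have "n \<ge> 1" using assms by (simp add: clique5_def)
  then show ?thesis
    using class_of_partition[of "V5 n" "C5 n" "{v}" v] coloring_5[of n] assms
    by (simp add: coloring_def C5_def)
qed

section \<open>The second upper bound\<close>

lemma max_weight_indep5_to_singleton:
  assumes "u \<in> indep5 n" "v \<in> clique5 n"
  shows "max_weight (c5 n) {e \<in> incident (E5 n) u. \<exists>w\<in>{v}. e = {u, w}} = 1"
proof -
  have "{u, v} \<in> cross5 n"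
    using assms by (simp add: doubleton_in_cross5_iff)
  moreover from this have "{e \<in> incident (E5 n) u. \<exists>w\<in>{v}. e = {u, w}} = {{u, v}}"
    by (auto simp: incident_def doubleton_in_E5_iff)
  ultimately show ?thesis
    by (simp add: max_weight_def c5_def)
qed

text \<open>
  This is what keeps the second bound small: the \<open>n\<close> edges from \<open>v\<close> to \<open>I\<close>, which all enter
  \<open>\<eta>\<close> of \<open>v\<close> in the third bound, together count as one.
\<close>

lemma max_weight_clique5_to_indep5:
  assumes "v \<in> clique5 n"
  shows "max_weight (c5 n) {e \<in> incident (E5 n) v. \<exists>u\<in>indep5 n. e = {v, u}} = 1"
proof -
  let ?F = "{e \<in> incident (E5 n) v. \<exists>u\<in>indep5 n. e = {v, u}}"
  have "c5 n e = 1" if "e \<in> ?F" for e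
    using that assms by (auto simp: c5_def doubleton_in_cross5_iff)
  moreover have "{v, 1} \<in> ?F"
    using assms
    by (auto simp: incident_def doubleton_in_E5_iff doubleton_in_cross5_iff indep5_def clique5_def)
  ultimately have "?F \<noteq> {}" "c5 n ` ?F = {1}"
    by (blast, force)
  then show ?thesis
    unfolding max_weight_def by simp
qed

lemma max_weight_clique5_to_singleton:
  assumes "v \<in> clique5 n" "w \<in> clique5 n"
  shows "max_weight (c5 n) {e \<in> incident (E5 n) v. \<exists>u\<in>{w}. e = {v, u}} = 0"
proof -
  let ?F = "{e \<in> incident (E5 n) v. \<exists>u\<in>{w}. e = {v, u}}"
  have "{v, w} \<notin> cross5 n"
    using assms indep5_clique5_disjoint[of n] by (auto simp: doubleton_in_cross5_iff)
  moreover have "?F = {} \<or> ?F = {{v, w}}"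
    by auto
  ultimately show ?thesis
    by (auto simp: max_weight_def c5_def)
qed

lemma sigma_indep5:
  assumes "u \<in> indep5 n" and irrefl: "\<not> R (indep5 n) (indep5 n)"
  shows "sigma (E5 n) (c5 n) (C5 n) R u = card {v \<in> clique5 n. R {v} (indep5 n)}"
proof -
  let ?P = "{v \<in> clique5 n. R {v} (indep5 n)}"
  have "{J \<in> C5 n. R J (indep5 n)} = (\<lambda>v. {v}) ` ?P"
    using irrefl by (auto simp: C5_def)
  then have "sigma (E5 n) (c5 n) (C5 n) R u =
      (\<Sum>v\<in>?P. max_weight (c5 n) {e \<in> incident (E5 n) u. \<exists>w\<in>{v}. e = {u, w}})"
    by (simp add: sigma_def class_of_indep5[OF assms(1)] sum.reindex)
  also have "\<dots> = (\<Sum>v\<in>?P. 1)"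
    by (intro sum.cong refl max_weight_indep5_to_singleton assms(1)) simp
  finally show ?thesis
    by simp
qed

lemma sigma_clique5:
  assumes "v \<in> clique5 n"
  shows "sigma (E5 n) (c5 n) (C5 n) R v = (if R (indep5 n) {v} then 1 else 0)"
proof -
  let ?S = "{J \<in> C5 n. R J {v}}"
  have "n \<ge> 1"
    using assms by (simp add: clique5_def)
  have "max_weight (c5 n) {e \<in> incident (E5 n) v. \<exists>u\<in>J. e = {v, u}}
      = (if J = indep5 n then 1 else 0)" if "J \<in> ?S" for J
  proof (cases "J = indep5 n")
    case True
    then show ?thesis
      using max_weight_clique5_to_indep5[OF assms] by simp
  next
    case False
    then obtain w where "w \<in> clique5 n" "J = {w}"
      using \<open>J \<in> ?S\<close> by (auto simp: C5_def)
    then show ?thesis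
      using max_weight_clique5_to_singleton[OF assms] False by simp
  qed
  then have "sigma (E5 n) (c5 n) (C5 n) R v = (\<Sum>J\<in>?S. if J = indep5 n then 1 else 0)"
    unfolding sigma_def class_of_clique5[OF assms] by (rule sum.cong[OF refl])
  also have "\<dots> = (if R (indep5 n) {v} then 1 else 0)"
    by (simp add: sum.delta C5_def clique5_def)
  finally show ?thesis .
qed

text \<open>
  Totality and asymmetry of the order put each singleton class on exactly one side of \<open>I\<close>; the
  maximum over \<open>I\<close> counts those before, the singletons after count themselves.
\<close>

lemma UB2_5:
  assumes "n \<ge> 1" and order: "strict_total_order_on (C5 n) R"
  shows "UB2 (E5 n) (c5 n) (C5 n) R = n"
proof -
  let ?I = "indep5 n" and ?C = "clique5 n"
  let ?\<sigma> = "sigma (E5 n) (c5 n) (C5 n) R"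
  let ?before = "{v \<in> ?C. R {v} ?I}" and ?after = "{v \<in> ?C. R ?I {v}}"
  have [simp]: "finite ?C" "card ?C = n"
    by (simp_all add: clique5_def)
  have irrefl: "\<not> R J J" if "J \<in> C5 n" for J
    using order that by (auto simp: strict_total_order_on_def irreflp_on_def)
  have I_in: "?I \<in> C5 n"
    by (simp add: C5_def)
  have "?\<sigma> ` ?I = {card ?before}"
  proof -
    have "?I \<noteq> {}"
      using assms(1) by (simp add: indep5_def)
    then show ?thesis
      using sigma_indep5[of _ n R, OF _ irrefl[OF I_in]] by auto
  qed
  moreover have "(\<Sum>v\<in>?C. ?\<sigma> v) = (\<Sum>v\<in>?C. if R ?I {v} then 1 else 0)"
    by (intro sum.cong refl sigma_clique5)
  then have "(\<Sum>v\<in>?C. ?\<sigma> v) = card ?after"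
    by (simp flip: sum.inter_filter)
  moreover have "UB2 (E5 n) (c5 n) (C5 n) R = Max (?\<sigma> ` ?I) + (\<Sum>v\<in>?C. ?\<sigma> v)"
    using indep5_not_singleton_class[OF assms(1)]
    by (simp add: UB2_def C5_def sum.reindex)
  ultimately have "UB2 (E5 n) (c5 n) (C5 n) R = card ?before + card ?after"
    by simp
  also have "\<dots> = card (?before \<union> ?after)"
  proof (rule card_Un_disjoint[symmetric])
    show "?before \<inter> ?after = {}"
    proof (rule ccontr)
      assume "?before \<inter> ?after \<noteq> {}"
      then obtain v where "{v} \<in> C5 n" "R {v} ?I" "R ?I {v}"
        by (auto simp: C5_def)
      then have "R ?I ?I"
        using order I_in unfolding strict_total_order_on_def transp_on_def by blast
      then show False
        using irrefl[OF I_in] by simp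
    qed
  qed simp_all
  also have "?before \<union> ?after = ?C"
  proof -
    have "R {v} ?I \<or> R ?I {v}" if "v \<in> ?C" for v
    proof -
      have "{v} \<in> C5 n" "{v} \<noteq> ?I"
        using that indep5_not_singleton_class[OF assms(1)] by (auto simp: C5_def)
      then show ?thesis
        using order I_in by (auto simp: strict_total_order_on_def totalp_on_def)
    qed
    then show ?thesis by auto
  qed
  finally show ?thesis by simp
qed

section \<open>The third upper bound\<close>

lemma card_incident_cross5:
  assumes "u \<in> V5 n"
  shows "card (incident (cross5 n) u) = n"
proof (cases "u \<in> indep5 n")
  case True
  then have "incident (cross5 n) u = (\<lambda>v. {u, v}) ` clique5 n"
    using indep5_clique5_disjoint[of n] by (auto simp: incident_def cross5_def)
  moreover have "inj_on (\<lambda>v. {u, v}) (clique5 n)"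
    by (auto simp: inj_on_def doubleton_eq_iff)
  ultimately show ?thesis
    by (simp add: card_image clique5_def)
next
  case False
  then have "u \<in> clique5 n"
    using assms by (auto simp: V5_def indep5_def clique5_def)
  then have "incident (cross5 n) u = (\<lambda>v. {u, v}) ` indep5 n"
    using indep5_clique5_disjoint[of n] by (auto simp: incident_def cross5_def)
  moreover have "inj_on (\<lambda>v. {u, v}) (indep5 n)"
    by (auto simp: inj_on_def doubleton_eq_iff)
  ultimately show ?thesis
    by (simp add: card_image indep5_def)
qed

lemma is_heaviest_cross5:
  assumes "u \<in> V5 n"
  shows "is_heaviest (E5 n) (c5 n) n u (incident (cross5 n) u)"
proof -
  have sub: "incident (cross5 n) u \<subseteq> incident (E5 n) u"
    by (auto simp: incident_def E5_def)
  then have "n \<le> card (incident (E5 n) u)"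
    using card_mono[OF incident_finite[OF simple_graph_5] sub] card_incident_cross5[OF assms]
    by simp
  with sub card_incident_cross5[OF assms] show ?thesis
    by (auto simp: is_heaviest_def incident_def c5_def)
qed

text \<open>
  All \<open>\<eta>\<close>-values being equal, any enumeration of the vertices is a descending one.
\<close>

lemma UB3_5:
  assumes "n \<ge> 1"
  shows "UB3 (V5 n) (E5 n) (c5 n) (n + 1) = real (n + 1) * (real n / 2)"
proof -
  let ?h = "\<lambda>_::nat. real n / 2"
  have "UB3 (V5 n) (E5 n) (c5 n) (n + 1) = (\<Sum>j = 1..n + 1. ?h (descending_order (V5 n) ?h j))"
  proof (rule UB3_choice[OF simple_graph_5, where D = "incident (cross5 n)" and h = ?h])
    show "n + 1 \<le> card (V5 n)"
      using assms by (simp add: V5_def)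
    show "is_heaviest (E5 n) (c5 n) (n + 1 - 1) u (incident (cross5 n) u)" if "u \<in> V5 n" for u
      using is_heaviest_cross5[OF that] by simp
    show "real n / 2 = 1/2 * (\<Sum>e\<in>incident (cross5 n) u. real (c5 n e))" if "u \<in> V5 n" for u
    proof -
      have "(\<Sum>e\<in>incident (cross5 n) u. real (c5 n e)) = (\<Sum>e\<in>incident (cross5 n) u. 1)"
        by (intro sum.cong) (auto simp: incident_def c5_def)
      then show ?thesis
        using card_incident_cross5[OF that] by simp
    qed
    show "is_descending_order (V5 n) ?h (descending_order (V5 n) ?h)"
      by (rule is_descending_order_descending_order) (simp add: V5_def)
  qed
  then show ?thesis by simp
qed

section \<open>The ratio of the bounds\<close>

theorem proposition7:
  fixes prec :: "nat \<Rightarrow> nat set \<Rightarrow> nat set \<Rightarrow> bool"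
  assumes "\<And>n. n \<ge> 2 \<Longrightarrow> strict_total_order_on (C5 n) (prec n)"
  shows "(\<forall>n\<ge>2. coloring (V5 n) (E5 n) (C5 n) \<and> card (C5 n) = n + 1) \<and>
    filterlim (\<lambda>n. UB3 (V5 n) (E5 n) (c5 n) (n + 1) / real (UB2 (E5 n) (c5 n) (C5 n) (prec n)))
      at_top sequentially"
proof
  show "\<forall>n\<ge>2. coloring (V5 n) (E5 n) (C5 n) \<and> card (C5 n) = n + 1"
    using coloring_5 card_C5 by simp
next
  have "1/2 * real n \<le> UB3 (V5 n) (E5 n) (c5 n) (n + 1) / real (UB2 (E5 n) (c5 n) (C5 n) (prec n))"
    if "n \<ge> 2" for n
    using UB3_5[of n] UB2_5[of n "prec n"] assms[OF that] that by (simp add: field_simps)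
  then have "\<forall>\<^sub>F n in sequentially. 1/2 * real n \<le>
      UB3 (V5 n) (E5 n) (c5 n) (n + 1) / real (UB2 (E5 n) (c5 n) (C5 n) (prec n))"
    by (rule eventually_sequentiallyI)
  moreover have "filterlim (\<lambda>n. 1/2 * real n) at_top sequentially"
    by (rule filterlim_tendsto_pos_mult_at_top[OF tendsto_const _ filterlim_real_sequentially]) simp
  ultimately show "filterlim (\<lambda>n. UB3 (V5 n) (E5 n) (c5 n) (n + 1) /
      real (UB2 (E5 n) (c5 n) (C5 n) (prec n))) at_top sequentially"
    by (rule filterlim_at_top_mono[rotated])
qed

end
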